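(* Let $G$ be a bicyclic graph of order $n$. Then $$HSO(G)\geq (n-3)\sqrt{2}+2\sqrt{13},$$ with equality if and only if $G\cong C'_n$ or $G\cong C''_n$ (that is, $G$ is isomorphic to some graph of the form $C'_n$ or of the form $C''_n$ for some admissible cycle lengths $p,q$).
   Context: All graphs are finite, simple and connected. For a graph $G$ with edge set $E(G)$, $d_i$ denotes the degree of the vertex $v_i$, and the Hyperbolic Sombor index is $HSO(G)=\sum_{v_iv_j\in E(G)}\frac{\sqrt{d_i^2+d_j^2}}{\min\{d_i,d_j\}}$. A bicyclic graph of order $n$ is a connected graph with $n$ vertices and $n+1$ edges. $C'_n$ and $C''_n$ denote $n$-vertex bicyclic graphs constructed from cycles $C_p$ ($p\ge 3$) and $C_q$ ($q\ge 3$) as follows: $C'_n$ is obtained by joining (a vertex of) $C_p$ and (a vertex of) $C_q$, taken vertex-disjoint, with a single edge (so that $p+q=n$); $C''_n$ is formed by merging $C_p$ and $C_q$ along a common edge, i.e. identifying one edge of $C_p$ with one edge of $C_q$ (so that $p+q-2=n$). *)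

theory Defs
  imports Complex_Main "Graph_Theory.Graph_Theory"
begin

text \<open>
  A finite simple graph is a \<^locale>\<open>pair_graph\<close>: a finite, loop-free, symmetric
  set of ordered pairs.  Each undirected edge thus appears as two opposite arcs, so the edge set
  has to be formed separately; the degree of a vertex is its \<^const>\<open>out_degree\<close>.
\<close>

definition edges :: "'a pair_pre_digraph \<Rightarrow> 'a set set" where
  "edges G = (\<lambda>(u, v). {u, v}) ` parcs G"

abbreviation degree :: "'a pair_pre_digraph \<Rightarrow> 'a \<Rightarrow> nat" where
  "degree G v \<equiv> out_degree (with_proj G) v"

abbreviation graph_iso :: "'a pair_pre_digraph \<Rightarrow> 'b pair_pre_digraph \<Rightarrow> bool" where
  "graph_iso G H \<equiv> digraph_iso (with_proj G) (with_proj H)"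

text \<open>
  For an edge \<open>e = {u, v}\<close> (with \<open>u \<noteq> v\<close>) the summand is
  \<open>sqrt (d\<^sub>u\<^sup>2 + d\<^sub>v\<^sup>2) / min d\<^sub>u d\<^sub>v\<close>.
\<close>

definition HSO :: "'a pair_pre_digraph \<Rightarrow> real" where
  "HSO G = (\<Sum>e\<in>edges G.
     sqrt (\<Sum>v\<in>e. (real (degree G v))\<^sup>2) / real (Min (degree G ` e)))"

text \<open>The constant \<open>connected\<close> is qualified because \<open>Complex_Main\<close> has a topological one.\<close>

definition bicyclic_graph :: "'a pair_pre_digraph \<Rightarrow> nat \<Rightarrow> bool" where
  "bicyclic_graph G n \<longleftrightarrow>
     pair_graph G \<and> Digraph_Component.connected (with_proj G) \<and>
     card (pverts G) = n \<and> card (edges G) = n + 1"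

definition cycle_graph :: "nat \<Rightarrow> nat pair_pre_digraph" where
  "cycle_graph p = \<lparr> pverts = {..<p},
     parcs = (\<Union>i<p. {(i, Suc i mod p), (Suc i mod p, i)}) \<rparr>"

text \<open>
  The graph \<open>C'\<close>: disjoint copies of the two cycles, joined by an edge between their
  vertices \<open>0\<close>.  As cycles are vertex-transitive, the choice of the end points does
  not matter up to isomorphism.
\<close>

definition joined_cycles :: "nat \<Rightarrow> nat \<Rightarrow> (nat + nat) pair_pre_digraph" where
  "joined_cycles p q = \<lparr> pverts = pverts (cycle_graph p) <+> pverts (cycle_graph q),
     parcs = map_prod Inl Inl ` parcs (cycle_graph p) \<union>
       map_prod Inr Inr ` parcs (cycle_graph q) \<union> {(Inl 0, Inr 0), (Inr 0, Inl 0)} \<rparr>"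

text \<open>
  The graph \<open>C''\<close>: the second cycle is attached to the first one by the injection
  \<open>glue p\<close>, which identifies the edge \<open>{0, 1}\<close> of the second cycle with the edge
  \<open>{0, 1}\<close> of the first one and sends its other vertices \<open>2, 3, \<dots>\<close> to
  the fresh vertices \<open>p, p + 1, \<dots>\<close>.  Again the choice of the two edges (and of the
  direction in which they are identified) does not matter up to isomorphism.
\<close>

definition glue :: "nat \<Rightarrow> nat \<Rightarrow> nat" where
  "glue p j = (if j < 2 then j else p + (j - 2))"

definition merged_cycles :: "nat \<Rightarrow> nat \<Rightarrow> nat pair_pre_digraph" where
  "merged_cycles p q = \<lparr> pverts = pverts (cycle_graph p) \<union> glue p ` pverts (cycle_graph q),
     parcs = parcs (cycle_graph p) \<union> map_prod (glue p) (glue p) ` parcs (cycle_graph q) \<rparr>"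

end

theory Submission
  imports Defs
begin

text \<open>
  Every edge contributes at least \<open>sqrt 2\<close> to the index, and a bicyclic graph has \<open>n + 1\<close> edges.
  Writing \<open>(n - 3) sqrt 2 + 2 sqrt 13 = (n + 1) sqrt 2 + 4 (sqrt (13/4) - sqrt 2)\<close> shows what has to
  be proved: the total excess over \<open>sqrt 2\<close> is at least that of four edges with end degrees 2 and 3.
  Such an edge has the least excess among all crossings, meaning edges between a vertex of degree at
  most 2 and one of degree at least 3.

  The crossings are counted from the set \<open>H\<close> of vertices of degree at least 3.  The degrees sum to
  \<open>2 n + 2\<close>, so with \<open>k\<close> pendant vertices the degree sum over \<open>H\<close> is \<open>2 \<bar>H\<bar> + k + 2\<close>, whence
  \<open>\<bar>H\<bar> \<le> k + 2\<close>.  Since pendant edges are expensive by themselves, only \<open>k \<le> 1\<close> needs attention; there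
  \<open>H\<close> is so small that few of its arcs stay inside and many have to leave
  (\<open>card_boundary_arcs\<close>, \<open>card_inner_arcs_le\<close>).  The bound is strict (\<open>total_excess_gt\<close>) unless
  the graph has two adjacent vertices of degree 3 and otherwise only vertices of degree 2
  (\<open>cubic_edge\<close>), and then it is attained (\<open>total_excess_cubic_edge\<close>).

  Finally, this degree pattern characterises the two families.  Deleting the edge between the
  vertices of degree 3 leaves a 2-regular graph, whose components are cycles
  (\<open>two_regular_cycle_through\<close>).  By connectedness there is either a single cycle, with the deleted
  edge as a chord, or one cycle through each end of the deleted edge (\<open>cubic_edge_classification\<close>).
\<close>

section \<open>Counting arcs\<close>

lemma degree_conv_card: "degree G v = card {w. (v, w) \<in> parcs G}"
proof -
  have "out_arcs (with_proj G) v = Pair v ` {w. (v, w) \<in> parcs G}"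
    by auto
  then show ?thesis
    by (simp add: out_degree_def card_image inj_on_def)
qed

lemma card_arcs_from:
  assumes "pair_fin_digraph G" "H \<subseteq> pverts G"
  shows "card {a \<in> parcs G. fst a \<in> H} = (\<Sum>v\<in>H. degree G v)"
proof -
  interpret pair_fin_digraph G by fact
  have fin: "finite H"
    using assms(2) pair_finite_verts by (rule finite_subset)
  have "{a \<in> parcs G. fst a \<in> H} = (\<Union>v\<in>H. out_arcs (with_proj G) v)"
    by auto
  also have "card \<dots> = (\<Sum>v\<in>H. card (out_arcs (with_proj G) v))"
    by (rule card_UN_disjoint) (use fin in \<open>auto\<close>)
  finally show ?thesis
    by (simp add: out_degree_def)
qed

lemma card_arcs_eq_sum_degree:
  assumes "pair_fin_digraph G"
  shows "card (parcs G) = (\<Sum>v\<in>pverts G. degree G v)"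
proof -
  interpret pair_fin_digraph G by fact
  have "{a \<in> parcs G. fst a \<in> pverts G} = parcs G"
    by (auto dest: in_arcsD1)
  then show ?thesis
    using card_arcs_from[OF assms, of "pverts G"] by simp
qed

text \<open>
  Sums over the edge set are turned into sums over arcs, because arcs can be counted by their tails;
  each edge is hit by exactly two arcs.
\<close>
lemma sum_arcs_eq_twice_sum_edges:
  fixes F :: "'a set \<Rightarrow> real"
  assumes "pair_graph G"
  shows "(\<Sum>a\<in>parcs G. F {fst a, snd a}) = 2 * (\<Sum>e\<in>edges G. F e)"
proof -
  interpret pair_graph G by fact
  let ?g = "\<lambda>a. {fst a, snd a}"
  have edges: "edges G = ?g ` parcs G"
    by (auto simp: edges_def case_prod_beta)
  have "(\<Sum>a\<in>parcs G. F (?g a)) = (\<Sum>e\<in>?g ` parcs G. \<Sum>a\<in>{a \<in> parcs G. ?g a = e}. F (?g a))"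
    by (rule sum.image_gen) (rule pair_finite_arcs)
  also have "\<dots> = (\<Sum>e\<in>?g ` parcs G. 2 * F e)"
  proof (rule sum.cong)
    fix e assume "e \<in> ?g ` parcs G"
    then obtain u v where uv: "(u, v) \<in> parcs G" "e = {u, v}"
      by auto
    then have "u \<noteq> v" "(v, u) \<in> parcs G"
      using no_loops' arcs_symmetric by auto
    with uv have "{a \<in> parcs G. ?g a = e} = {(u, v), (v, u)}"
      by (auto simp: doubleton_eq_iff)
    with \<open>u \<noteq> v\<close> uv(2) show "(\<Sum>a\<in>{a \<in> parcs G. ?g a = e}. F (?g a)) = 2 * F e"
      by (simp add: insert_commute)
  qed simp
  finally show ?thesis
    by (simp add: edges sum_distrib_left)
qed

lemma card_arcs_eq_twice_card_edges:
  assumes "pair_graph G"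
  shows "card (parcs G) = 2 * card (edges G)"
  using sum_arcs_eq_twice_sum_edges[OF assms, of "\<lambda>_. 1"]
  by (simp flip: of_nat_mult)

text \<open>
  The only form in which connectedness is used: a vertex that reaches everything cannot be confined
  to a proper arc-closed set.
\<close>
lemma connected_closed_set_eq_verts:
  assumes "pair_graph G" "Digraph_Component.connected (with_proj G)"
    and "S \<subseteq> pverts G" "x \<in> S"
    and closed: "\<And>a b. a \<in> S \<Longrightarrow> (a, b) \<in> parcs G \<Longrightarrow> b \<in> S"
  shows "S = pverts G"
proof
  interpret pair_graph G by fact
  show "pverts G \<subseteq> S"
  proof
    fix y assume "y \<in> pverts G"
    then have "x \<rightarrow>\<^sup>*\<^bsub>with_proj (mk_symmetric (with_proj G))\<^esub> y"
      using assms(2-4) by (auto simp: connected_def strongly_connected_def)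
    then have "x \<rightarrow>\<^sup>*\<^bsub>with_proj G\<^esub> y"
      using reachable_mk_symmetric_eq[OF sym_arcs] by simp
    then show "y \<in> S"
      by (induct rule: reachable_induct) (use assms(4) closed in auto)
  qed
qed fact

section \<open>The excess of an edge\<close>

text \<open>
  The amount by which an edge with end degrees \<open>a\<close>, \<open>b\<close> exceeds the least possible contribution
  \<open>sqrt 2\<close> to the index.  It only depends on the ratio of the larger to the smaller degree, and
  grows with it.
\<close>
definition excess :: "nat \<Rightarrow> nat \<Rightarrow> real" where
  "excess a b = sqrt ((real a)\<^sup>2 + (real b)\<^sup>2) / real (min a b) - sqrt 2"

lemma excess_commute: "excess a b = excess b a"
  by (simp add: excess_def min.commute add.commute)

lemma excess_eq:
  assumes "0 < a" "a \<le> b"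
  shows "excess a b = sqrt (1 + (real b / real a)\<^sup>2) - sqrt 2"
proof -
  have "sqrt ((real a)\<^sup>2 + (real b)\<^sup>2) = sqrt ((real a)\<^sup>2 * (1 + (real b / real a)\<^sup>2))"
    using assms by (simp add: field_simps)
  then show ?thesis
    using assms by (simp add: excess_def real_sqrt_mult)
qed

lemma excess_ge:
  assumes "0 < a" "a \<le> b" "0 \<le> r" "r * real a \<le> real b"
  shows "sqrt (1 + r\<^sup>2) - sqrt 2 \<le> excess a b"
proof -
  have "r \<le> real b / real a"
    using assms by (simp add: field_simps)
  then have "r\<^sup>2 \<le> (real b / real a)\<^sup>2"
    using assms by (intro power_mono) auto
  then show ?thesis
    using assms by (simp add: excess_eq)
qed

lemma excess_nonneg: "0 < a \<Longrightarrow> 0 < b \<Longrightarrow> 0 \<le> excess a b"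
  using excess_ge[of a b 1] excess_ge[of b a 1] excess_commute[of a b]
  by (cases "a \<le> b") auto

lemma excess_same: "0 < a \<Longrightarrow> excess a a = 0"
  by (simp add: excess_eq)

lemma excess_2_3: "excess 2 3 = sqrt (13/4) - sqrt 2"
  by (simp add: excess_eq power2_eq_square)

text \<open>
  An edge joining a vertex of degree at most 2 to one of degree at least 3 has degree ratio at least
  \<open>3/2\<close>, so \<open>excess 2 3\<close> is the cheapest price for crossing between the two classes.
\<close>
lemma excess_ge_excess_2_3:
  assumes "0 < a" "a \<le> 2" "3 \<le> b"
  shows "excess 2 3 \<le> excess a b"
proof -
  have "3/2 * real a \<le> real b" using assms by linarith
  from excess_ge[OF _ _ _ this] show ?thesis
    using assms by (simp add: excess_2_3 power2_eq_square)
qed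

lemma excess_ge_twice:
  assumes "0 < a" "2 * a \<le> b"
  shows "sqrt 5 - sqrt 2 \<le> excess a b"
  using excess_ge[of a b 2] assms by simp

lemma excess_ge_thrice:
  assumes "0 < a" "3 * a \<le> b"
  shows "sqrt 10 - sqrt 2 \<le> excess a b"
  using excess_ge[of a b 3] assms by simp

text \<open>
  In the order of the claims: crossings cost something; a ratio of 2 costs more than a crossing; two
  edges of ratio 2, or a single one of ratio 3, cost more than four crossings (both sides are
  doubled, since every edge is counted as two arcs).
\<close>
lemma excess_comparisons:
  shows "excess 2 3 > 0"
    and "sqrt 5 - sqrt 2 > excess 2 3"
    and "4 * (sqrt 5 - sqrt 2) > 8 * excess 2 3"
    and "2 * (sqrt 10 - sqrt 2) > 8 * excess 2 3"
proof -
  have b: "707/500 < sqrt 2" "559/250 < sqrt 5" "1581/500 < sqrt 10"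
     by (rule real_less_rsqrt; simp add: power2_eq_square)+
  define c where "c = sqrt (13/4)"
  have c: "excess 2 3 = c - sqrt 2"
    by (simp add: c_def excess_2_3)
  have b2: "c < 1803/1000"
    unfolding c_def by (rule real_less_lsqrt; simp add: power2_eq_square)
  show "excess 2 3 > 0" by (simp add: excess_2_3)
  show "sqrt 5 - sqrt 2 > excess 2 3"
    and "4 * (sqrt 5 - sqrt 2) > 8 * excess 2 3"
    and "2 * (sqrt 10 - sqrt 2) > 8 * excess 2 3"
    unfolding c by (use b b2 in argo)+
qed

definition total_excess :: "'a pair_pre_digraph \<Rightarrow> real" where
  "total_excess G = (\<Sum>(x, y)\<in>parcs G. excess (degree G x) (degree G y))"

lemma HSO_eq_total_excess:
  assumes "pair_graph G"
  shows "2 * HSO G = card (parcs G) * sqrt 2 + total_excess G"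
proof -
  interpret pair_graph G by fact
  let ?F = "\<lambda>e. sqrt (\<Sum>v\<in>e. (real (degree G v))\<^sup>2) / real (Min (degree G ` e))"
  have "2 * HSO G = (\<Sum>a\<in>parcs G. ?F {fst a, snd a})"
    unfolding HSO_def using sum_arcs_eq_twice_sum_edges[OF assms, of ?F] by simp
  also have "\<dots> = (\<Sum>(x, y)\<in>parcs G. sqrt 2 + excess (degree G x) (degree G y))"
    by (rule sum.cong) (auto simp: excess_def dest: no_loops')
  also have "\<dots> = card (parcs G) * sqrt 2 + total_excess G"
    by (simp add: total_excess_def case_prod_beta sum.distrib)
  finally show ?thesis .
qed

section \<open>The arcs leaving a vertex set\<close>

definition boundary_arcs :: "'a pair_pre_digraph \<Rightarrow> 'a set \<Rightarrow> ('a \<times> 'a) set" where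
  "boundary_arcs G S = {(x, y) \<in> parcs G. x \<in> S \<and> y \<notin> S}"

definition inner_arcs :: "'a pair_pre_digraph \<Rightarrow> 'a set \<Rightarrow> ('a \<times> 'a) set" where
  "inner_arcs G S = {(x, y) \<in> parcs G. x \<in> S \<and> y \<in> S}"

text \<open>
  A set with few inner arcs has many arcs leaving it.  Applied to the set of vertices of degree at
  least 3, which is small in a bicyclic graph, this is the source of all crossings.
\<close>
lemma card_boundary_arcs:
  assumes "pair_fin_digraph G" "S \<subseteq> pverts G"
  shows "card (boundary_arcs G S) + card (inner_arcs G S) = (\<Sum>v\<in>S. degree G v)"
proof -
  interpret pair_fin_digraph G by fact
  have "finite (boundary_arcs G S)" "finite (inner_arcs G S)"
    by (rule finite_subset[OF _ pair_finite_arcs]; auto simp: boundary_arcs_def inner_arcs_def)+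
  then have "card (boundary_arcs G S) + card (inner_arcs G S) = card (boundary_arcs G S \<union> inner_arcs G S)"
    by (intro card_Un_disjoint[symmetric]) (auto simp: boundary_arcs_def inner_arcs_def)
  also have "boundary_arcs G S \<union> inner_arcs G S = {a \<in> parcs G. fst a \<in> S}"
    by (auto simp: boundary_arcs_def inner_arcs_def)
  finally show ?thesis
    using card_arcs_from[OF assms] by simp
qed

lemma card_inner_arcs_le:
  assumes "pair_graph G" "finite S"
  shows "card (inner_arcs G S) \<le> card S * (card S - 1)"
proof -
  interpret pair_graph G by fact
  have "inner_arcs G S \<subseteq> (SIGMA x:S. S - {x})"
    by (auto simp: inner_arcs_def dest: no_loops')
  then have "card (inner_arcs G S) \<le> card (SIGMA x:S. S - {x})"
    using assms(2) by (intro card_mono) auto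
  also have "\<dots> = card S * (card S - 1)"
    using assms(2) by simp
  finally show ?thesis .
qed

text \<open>
  Excess is symmetric, so the leaving arcs and their reversals contribute equally.
\<close>
lemma sum_excess_boundary:
  assumes "pair_graph G"
  shows "(\<Sum>(x, y)\<in>boundary_arcs G S \<union> (boundary_arcs G S)\<inverse>. excess (degree G x) (degree G y))
    = 2 * (\<Sum>(x, y)\<in>boundary_arcs G S. excess (degree G x) (degree G y))"
proof -
  interpret pair_graph G by fact
  let ?E = "\<lambda>(x, y). excess (degree G x) (degree G y)"
  have fin: "finite (boundary_arcs G S)"
    by (rule finite_subset[OF _ pair_finite_arcs]) (auto simp: boundary_arcs_def)
  have conv: "(boundary_arcs G S)\<inverse> = prod.swap ` boundary_arcs G S"
    by auto
  have "sum ?E ((boundary_arcs G S)\<inverse>) = sum ?E (boundary_arcs G S)"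
    unfolding conv by (subst sum.reindex)
      (auto intro!: sum.cong simp: excess_commute)
  moreover have "sum ?E (boundary_arcs G S \<union> (boundary_arcs G S)\<inverse>) = sum ?E (boundary_arcs G S) + sum ?E ((boundary_arcs G S)\<inverse>)"
    using fin by (intro sum.union_disjoint) (auto simp: boundary_arcs_def)
  ultimately show ?thesis
    by simp
qed

lemma total_excess_ge_sum:
  assumes "pair_graph G" "\<And>v. v \<in> pverts G \<Longrightarrow> 0 < degree G v" "S \<subseteq> parcs G"
  shows "(\<Sum>(x, y)\<in>S. excess (degree G x) (degree G y)) \<le> total_excess G"
proof -
  interpret pair_graph G by fact
  show ?thesis
    unfolding total_excess_def using assms(2,3)
    by (intro sum_mono2) (auto intro!: excess_nonneg dest: in_arcsD1 in_arcsD2)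
qed

lemma boundary_arcs_subset:
  assumes "pair_graph G"
  shows "boundary_arcs G S \<union> (boundary_arcs G S)\<inverse> \<subseteq> parcs G"
proof -
  interpret pair_graph G by fact
  show ?thesis by (auto simp: boundary_arcs_def intro: arcs_symmetric)
qed

lemma sum_excess_boundary_ge:
  assumes "pair_graph G"
    and "\<And>x y. (x, y) \<in> boundary_arcs G S \<Longrightarrow> m \<le> excess (degree G x) (degree G y)"
  shows "2 * (real (card (boundary_arcs G S)) * m)
    \<le> (\<Sum>(x, y)\<in>boundary_arcs G S \<union> (boundary_arcs G S)\<inverse>. excess (degree G x) (degree G y))"
  unfolding sum_excess_boundary[OF assms(1)]
  using assms(2) by (intro mult_left_mono sum_bounded_below) auto

lemma total_excess_ge_boundary:
  assumes "pair_graph G" "\<And>v. v \<in> pverts G \<Longrightarrow> 0 < degree G v"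
    and "\<And>x y. (x, y) \<in> boundary_arcs G S \<Longrightarrow> m \<le> excess (degree G x) (degree G y)"
  shows "2 * (real (card (boundary_arcs G S)) * m) \<le> total_excess G"
  using sum_excess_boundary_ge[OF assms(1,3)]
    total_excess_ge_sum[OF assms(1,2) boundary_arcs_subset[OF assms(1)]] by (rule order_trans)

section \<open>The degree pattern of the extremal graphs\<close>

text \<open>
  The equality case of the bound, in terms of degrees alone.
\<close>
definition cubic_edge :: "'a pair_pre_digraph \<Rightarrow> 'a \<Rightarrow> 'a \<Rightarrow> bool" where
  "cubic_edge G u v \<longleftrightarrow> (u, v) \<in> parcs G \<and> u \<noteq> v \<and> {u, v} \<subseteq> pverts G \<and>
     degree G u = 3 \<and> degree G v = 3 \<and> (\<forall>w\<in>pverts G - {u, v}. degree G w = 2)"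

text \<open>
  The arcs not crossing between \<open>{u, v}\<close> and its complement join vertices of equal degree; of the
  six arcs leaving \<open>u\<close> or \<open>v\<close>, the two along the edge \<open>{u, v}\<close> do not cross, which leaves four.
\<close>
lemma total_excess_cubic_edge:
  assumes "pair_graph G" "cubic_edge G u v"
  shows "total_excess G = 8 * excess 2 3"
proof -
  interpret pair_graph G by fact
  let ?E = "\<lambda>(x, y). excess (degree G x) (degree G y)"
  let ?C = "boundary_arcs G {u, v}"
  have uv: "(u, v) \<in> parcs G" "(v, u) \<in> parcs G" "u \<noteq> v" "{u, v} \<subseteq> pverts G"
    "degree G u = 3" "degree G v = 3" "\<And>w. w \<in> pverts G \<Longrightarrow> w \<notin> {u, v} \<Longrightarrow> degree G w = 2"
    using assms(2) arcs_symmetric by (auto simp: cubic_edge_def)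
  have inner: "inner_arcs G {u, v} = {(u, v), (v, u)}"
    using uv no_loops' by (auto simp: inner_arcs_def)
  have "card ?C + card (inner_arcs G {u, v}) = 6"
    using card_boundary_arcs[of G "{u, v}"] uv pair_fin_digraph by simp
  then have card: "card ?C = 4"
    using uv(3) by (simp add: inner)
  have flat: "?E a = 0" if "a \<in> parcs G - (?C \<union> ?C\<inverse>)" for a
  proof -
    obtain x y where a: "a = (x, y)" by force
    with that have *: "(x, y) \<in> parcs G" "x \<in> {u, v} \<longleftrightarrow> y \<in> {u, v}"
      using arcs_symmetric by (auto simp: boundary_arcs_def)
    have "degree G x = degree G y" "0 < degree G y"
      using * uv(5-7) in_arcsD1[OF *(1)] in_arcsD2[OF *(1)] by (cases "x \<in> {u, v}"; auto)+
    then show ?thesis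
      by (simp add: a excess_same)
  qed
  have "total_excess G = sum ?E (?C \<union> ?C\<inverse>)"
    unfolding total_excess_def
    by (rule sum.mono_neutral_right[OF pair_finite_arcs boundary_arcs_subset[OF assms(1)]])
      (use flat in blast)
  also have "\<dots> = 2 * sum ?E ?C"
    by (rule sum_excess_boundary[OF assms(1)])
  also have "sum ?E ?C = (\<Sum>a\<in>?C. excess 2 3)"
  proof (rule sum.cong)
    fix a assume "a \<in> ?C"
    then obtain x y where a: "a = (x, y)" "(x, y) \<in> parcs G" "x \<in> {u, v}" "y \<notin> {u, v}"
      by (auto simp: boundary_arcs_def)
    then have "degree G x = 3" "degree G y = 2"
      using uv(5-7) in_arcsD2[OF a(2)] by auto
    then show "?E a = excess 2 3"
      by (simp add: a(1) excess_commute)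
  qed simp
  finally show ?thesis
    by (simp add: card)
qed

section \<open>Degrees in bicyclic graphs\<close>

lemma bicyclic_card_arcs:
  assumes "bicyclic_graph G n"
  shows "(\<Sum>v\<in>pverts G. degree G v) = 2 * n + 2"
proof -
  have "pair_graph G" "card (edges G) = n + 1"
    using assms by (auto simp: bicyclic_graph_def)
  then interpret pair_graph G by simp
  show ?thesis
    using card_arcs_eq_twice_card_edges[OF \<open>pair_graph G\<close>]
      card_arcs_eq_sum_degree[OF pair_fin_digraph] \<open>card (edges G) = n + 1\<close> by simp
qed

text \<open>
  An isolated vertex would be the whole graph, which has too few arcs; the same count excludes an
  isolated edge in the lemma on pendant vertices below.
\<close>
lemma bicyclic_degree_pos:
  assumes "bicyclic_graph G n" "x \<in> pverts G"
  shows "0 < degree G x"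
proof (rule ccontr)
  assume "\<not> 0 < degree G x"
  interpret pair_graph G using assms(1) by (simp add: bicyclic_graph_def)
  have "(x, y) \<notin> parcs G" for y
  proof
    assume "(x, y) \<in> parcs G"
    then have "(x, y) \<in> out_arcs (with_proj G) x" by simp
    with finite_out_arcs[of x] have "0 < degree G x"
      unfolding out_degree_def by (metis card_gt_0_iff empty_iff)
    with \<open>\<not> 0 < degree G x\<close> show False by simp
  qed
  then have "{x} = pverts G"
    using assms by (intro connected_closed_set_eq_verts) (auto simp: bicyclic_graph_def)
  then have "(\<Sum>v\<in>pverts G. degree G v) = (\<Sum>v\<in>{x}. degree G v)"
    by simp
  then show False
    using bicyclic_card_arcs[OF assms(1)] \<open>\<not> 0 < degree G x\<close> by simp
qed

lemma degree_1_unique_nbr: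
  assumes "degree G x = 1" "(x, y) \<in> parcs G" "(x, z) \<in> parcs G"
  shows "z = y"
proof -
  obtain w where "{w. (x, w) \<in> parcs G} = {w}"
    using assms(1) by (auto simp: degree_conv_card card_1_singleton_iff)
  then have "z = w" "y = w"
    using assms(2,3) by blast+
  then show ?thesis by simp
qed

lemma bicyclic_pendant_nbr:
  assumes "bicyclic_graph G n" "degree G x = 1" "(x, y) \<in> parcs G"
  shows "2 \<le> degree G y"
proof (rule ccontr)
  interpret pair_graph G using assms(1) by (simp add: bicyclic_graph_def)
  assume "\<not> 2 \<le> degree G y"
  with bicyclic_degree_pos[OF assms(1)] in_arcsD2[OF assms(3)] have y: "degree G y = 1"
    by (metis One_nat_def Suc_1 Suc_leI le_neq_implies_less)
  have "b \<in> {x, y}" if "a \<in> {x, y}" "(a, b) \<in> parcs G" for a b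
    using that degree_1_unique_nbr[OF assms(2,3), of b]
      degree_1_unique_nbr[OF y arcs_symmetric[OF assms(3)], of b] by blast
  then have "{x, y} = pverts G"
    using assms(1) in_arcsD1[OF assms(3)] in_arcsD2[OF assms(3)]
    by (intro connected_closed_set_eq_verts[where x = x]) (auto simp: bicyclic_graph_def)
  moreover from this have "n = 2"
    using assms(1) no_loops'[OF assms(3)] by (auto simp: bicyclic_graph_def simp flip: \<open>{x, y} = pverts G\<close>)
  moreover have "(\<Sum>v\<in>{x, y}. degree G v) = 2"
    using y assms(2) no_loops'[OF assms(3)] by simp
  ultimately show False
    using bicyclic_card_arcs[OF assms(1)] by simp
qed

text \<open>
  The degrees exceed 2 by exactly 2 in total, and each pendant vertex has to be compensated by the
  vertices of degree at least 3.  As each of those contributes at least 1 to that compensation, there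
  are at most two more of them than pendant vertices.
\<close>
lemma bicyclic_sum_large_degrees:
  assumes "bicyclic_graph G n"
  shows "(\<Sum>v | v \<in> pverts G \<and> 3 \<le> degree G v. degree G v) =
    2 * card {v \<in> pverts G. 3 \<le> degree G v} + card {v \<in> pverts G. degree G v = 1} + 2"
proof -
  interpret pair_graph G using assms(1) by (simp add: bicyclic_graph_def)
  let ?P = "{v \<in> pverts G. degree G v = 1}" and ?T = "{v \<in> pverts G. degree G v = 2}"
    and ?H = "{v \<in> pverts G. 3 \<le> degree G v}"
  have "0 < degree G v" if "v \<in> pverts G" for v
    using bicyclic_degree_pos[OF assms that] .
  then have split: "pverts G = ?P \<union> (?T \<union> ?H)" by force
  have fin: "finite ?P" "finite ?T" "finite ?H" using pair_finite_verts by auto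
  have "card (pverts G) = card ?P + (card ?T + card ?H)"
    using fin by (subst split, subst card_Un_disjoint)
       (auto intro!: card_Un_disjoint)
  moreover have "(\<Sum>v\<in>pverts G. degree G v) = sum (degree G) ?P + (sum (degree G) ?T + sum (degree G) ?H)"
  proof -
    have "sum (degree G) (?P \<union> (?T \<union> ?H)) = sum (degree G) ?P + sum (degree G) (?T \<union> ?H)"
      using fin by (intro sum.union_disjoint) auto
    also have "sum (degree G) (?T \<union> ?H) = sum (degree G) ?T + sum (degree G) ?H"
      using fin by (intro sum.union_disjoint) auto
    finally show ?thesis using split by simp
  qed
  moreover have "sum (degree G) ?P = card ?P" "sum (degree G) ?T = 2 * card ?T"
    by simp_all
  ultimately show ?thesis
    using bicyclic_card_arcs[OF assms] assms by (simp add: bicyclic_graph_def)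
qed

section \<open>The lower bound\<close>

text \<open>
  Either one vertex has degree 4, with four edges of degree ratio 2, or two nonadjacent vertices have
  degree 3, with six crossings instead of four.
\<close>
lemma total_excess_gt_no_pendant:
  assumes "bicyclic_graph G n" "\<And>v. v \<in> pverts G \<Longrightarrow> degree G v \<noteq> 1"
    and "\<nexists>u v. cubic_edge G u v"
  shows "8 * excess 2 3 < total_excess G"
proof -
  interpret pair_graph G using assms(1) by (simp add: bicyclic_graph_def)
  note pos = bicyclic_degree_pos[OF assms(1)]
  define H where "H = {v \<in> pverts G. 3 \<le> degree G v}"
  have H: "finite H" "H \<subseteq> pverts G"
    using pair_finite_verts by (auto simp: H_def)
  have two: "degree G v = 2" if "v \<in> pverts G" "v \<notin> H" for v
    using that pos[of v] assms(2)[of v] unfolding H_def by simp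
  have "{v \<in> pverts G. degree G v = 1} = {}"
    using assms(2) by auto
  then have sum: "(\<Sum>v\<in>H. degree G v) = 2 * card H + 2"
    using bicyclic_sum_large_degrees[OF assms(1)] by (simp only: H_def[symmetric] card.empty)
  have "(\<Sum>v\<in>H. 3) \<le> (\<Sum>v\<in>H. degree G v)"
    by (rule sum_mono) (simp add: H_def)
  then have "card H \<le> 2" "card H \<noteq> 0"
    using sum H(1) by auto
  then consider "card H = 1" | "card H = 2" by linarith
  then show ?thesis
  proof cases
    case 1
    then obtain v where v: "H = {v}" by (auto simp: card_1_singleton_iff)
    then have d: "degree G v = 4" using sum by simp
    have "sqrt 5 - sqrt 2 \<le> excess (degree G x) (degree G y)" if "(x, y) \<in> boundary_arcs G H" for x y
    proof -
      have "x = v" "degree G y = 2"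
        using that two in_arcsD2 v by (auto simp: boundary_arcs_def)
      then show ?thesis
        using excess_ge_twice[of 2 4] by (simp add: d excess_commute)
    qed
    from total_excess_ge_boundary[OF pair_graph pos this]
    have "2 * (real (card (boundary_arcs G H)) * (sqrt 5 - sqrt 2)) \<le> total_excess G" by blast
    moreover have "card (boundary_arcs G H) = 4"
      using card_boundary_arcs[OF pair_fin_digraph H(2)] card_inner_arcs_le[OF pair_graph H(1)]
        sum 1 by simp
    ultimately show ?thesis
      using excess_comparisons(2) by simp
  next
    case 2
    then obtain u v where uv: "H = {u, v}" "u \<noteq> v" by (auto simp: card_2_iff)
    then have "3 \<le> degree G u" "3 \<le> degree G v"
      by (auto simp: H_def)
    then have d: "degree G u = 3" "degree G v = 3"
      using sum uv by auto
    have "(u, v) \<notin> parcs G"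
      using assms(3) uv d two H(2) by (auto simp: cubic_edge_def)
    then have "inner_arcs G H = {}"
      using uv no_loops' arcs_symmetric by (auto simp: inner_arcs_def)
    then have card: "card (boundary_arcs G H) = 6"
      using card_boundary_arcs[OF pair_fin_digraph H(2)] sum 2 by simp
    have "excess 2 3 \<le> excess (degree G x) (degree G y)" if "(x, y) \<in> boundary_arcs G H" for x y
    proof -
      have "x \<in> {u, v}" "degree G y = 2"
        using that two in_arcsD2 uv(1) by (auto simp: boundary_arcs_def)
      then show ?thesis
        by (auto simp: d excess_commute)
    qed
    from total_excess_ge_boundary[OF pair_graph pos this]
    have "2 * (real (card (boundary_arcs G H)) * excess 2 3) \<le> total_excess G" by blast
    then show ?thesis
      using card excess_comparisons(1) by simp
  qed
qed

text \<open>
  The edges at two pendant vertices are distinct and have degree ratio at least 2, which is enough.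
\<close>
lemma total_excess_gt_two_pendants:
  assumes "bicyclic_graph G n" "p \<in> pverts G" "q \<in> pverts G" "p \<noteq> q"
    and "degree G p = 1" "degree G q = 1"
  shows "8 * excess 2 3 < total_excess G"
proof -
  interpret pair_graph G using assms(1) by (simp add: bicyclic_graph_def)
  note pos = bicyclic_degree_pos[OF assms(1)]
  note nbr = bicyclic_pendant_nbr[OF assms(1)]
  have "inner_arcs G {p, q} = {}"
    using nbr[OF assms(5)] nbr[OF assms(6)] assms(5,6) by (force simp: inner_arcs_def)
  then have card: "card (boundary_arcs G {p, q}) = 2"
    using card_boundary_arcs[OF pair_fin_digraph, of "{p, q}"] assms by simp
  have "sqrt 5 - sqrt 2 \<le> excess (degree G x) (degree G y)" if "(x, y) \<in> boundary_arcs G {p, q}" for x y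
    using that nbr[of x y] assms(5,6) by (intro excess_ge_twice) (auto simp: boundary_arcs_def)
  from total_excess_ge_boundary[OF pair_graph pos this]
  have "2 * (real (card (boundary_arcs G {p, q})) * (sqrt 5 - sqrt 2)) \<le> total_excess G" by blast
  then show ?thesis
    using card excess_comparisons(3) by simp
qed

text \<open>
  If the neighbour of the pendant vertex has degree at least 3, their edge alone is expensive enough.
  Otherwise this edge costs more than one crossing, and it is not itself a crossing.  The set
  \<open>H\<close> of vertices of degree at least 3 then supplies three crossings: it has \<open>h \<le> 3\<close> elements and
  degree sum \<open>2 h + 3\<close>, while at most \<open>h (h - 1)\<close> arcs stay inside, and
  \<open>2 h + 3 - h (h - 1) \<ge> 3\<close> for these \<open>h\<close>.
\<close>
lemma total_excess_gt_one_pendant: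
  assumes "bicyclic_graph G n" "{v \<in> pverts G. degree G v = 1} = {p}"
  shows "8 * excess 2 3 < total_excess G"
proof -
  interpret pair_graph G using assms(1) by (simp add: bicyclic_graph_def)
  note pos = bicyclic_degree_pos[OF assms(1)]
  have "p \<in> {v \<in> pverts G. degree G v = 1}" using assms(2) by simp
  then have p: "p \<in> pverts G" "degree G p = 1" by simp_all
  then obtain w where w: "{y. (p, y) \<in> parcs G} = {w}"
    by (auto simp: degree_conv_card card_1_singleton_iff)
  then have pw: "(p, w) \<in> parcs G" "p \<noteq> w"
    using no_loops' by auto
  have bp: "boundary_arcs G {p} = {(p, w)}"
    using w pw by (auto simp: boundary_arcs_def)
  have w2: "2 \<le> degree G w"
    using bicyclic_pendant_nbr[OF assms(1) p(2) pw(1)] .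
  show ?thesis
  proof (cases "3 \<le> degree G w")
    case True
    have "sqrt 10 - sqrt 2 \<le> excess (degree G x) (degree G y)" if "(x, y) \<in> boundary_arcs G {p}" for x y
      using that True p by (intro excess_ge_thrice) (auto simp: bp)
    from total_excess_ge_boundary[OF pair_graph pos this]
    have "2 * (real (card (boundary_arcs G {p})) * (sqrt 10 - sqrt 2)) \<le> total_excess G" by blast
    then have "2 * (sqrt 10 - sqrt 2) \<le> total_excess G" by (simp add: bp)
    then show ?thesis
      using excess_comparisons(4) by simp
  next
    case False
    define H where "H = {v \<in> pverts G. 3 \<le> degree G v}"
    have H: "finite H" "H \<subseteq> pverts G"
      using pair_finite_verts by (auto simp: H_def)
    have sum: "(\<Sum>v\<in>H. degree G v) = 2 * card H + 3"
      using bicyclic_sum_large_degrees[OF assms(1)] unfolding assms(2) by (simp flip: H_def)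
    have "(\<Sum>v\<in>H. 3) \<le> (\<Sum>v\<in>H. degree G v)"
      by (rule sum_mono) (simp add: H_def)
    then have "card H \<le> 3" "card H \<noteq> 0"
      using sum H(1) by auto
    then have "card H \<in> {1, 2, 3}" by auto
    then have card: "3 \<le> card (boundary_arcs G H)"
      using card_boundary_arcs[OF pair_fin_digraph H(2)] card_inner_arcs_le[OF pair_graph H(1)]
        sum by auto
    let ?E = "\<lambda>(x, y). excess (degree G x) (degree G y)"
    let ?B = "\<lambda>S. boundary_arcs G S \<union> (boundary_arcs G S)\<inverse>"
    have "p \<notin> H" "w \<notin> H" using p False by (auto simp: H_def)
    then have disj: "?B {p} \<inter> ?B H = {}"
      by (auto simp: bp) (auto simp: boundary_arcs_def)
    have "excess 2 3 \<le> excess (degree G x) (degree G y)" if "(x, y) \<in> boundary_arcs G H" for x y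
    proof -
      have "3 \<le> degree G x" "degree G y \<le> 2" "y \<in> pverts G"
        using that in_arcsD2 by (auto simp: boundary_arcs_def H_def)
      then show ?thesis
        using excess_ge_excess_2_3[OF pos] by (subst (2) excess_commute) auto
    qed
    then have "2 * (real (card (boundary_arcs G H)) * excess 2 3) \<le> sum ?E (?B H)"
      by (rule sum_excess_boundary_ge[OF pair_graph])
    moreover have "2 * (3 * excess 2 3) \<le> 2 * (real (card (boundary_arcs G H)) * excess 2 3)"
      using card excess_comparisons(1) by simp
    ultimately have "6 * excess 2 3 \<le> sum ?E (?B H)"
      by linarith
    moreover have "sqrt 5 - sqrt 2 \<le> excess (degree G x) (degree G y)"
      if "(x, y) \<in> boundary_arcs G {p}" for x y
      using that w2 p by (intro excess_ge_twice) (auto simp: bp)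
    then have "2 * (real (card (boundary_arcs G {p})) * (sqrt 5 - sqrt 2)) \<le> sum ?E (?B {p})"
      by (rule sum_excess_boundary_ge[OF pair_graph])
    then have "2 * (sqrt 5 - sqrt 2) \<le> sum ?E (?B {p})"
      by (simp add: bp)
    moreover have "sum ?E (?B {p}) + sum ?E (?B H) = sum ?E (?B {p} \<union> ?B H)"
      by (rule sum.union_disjoint[symmetric, OF _ _ disj];
        rule finite_subset[OF boundary_arcs_subset[OF pair_graph] pair_finite_arcs])
    moreover have "sum ?E (?B {p} \<union> ?B H) \<le> total_excess G"
      using boundary_arcs_subset[OF pair_graph]
      by (intro total_excess_ge_sum[OF pair_graph pos]) blast+
    ultimately show ?thesis
      using excess_comparisons(2) by argo
  qed
qed

lemma total_excess_gt:
  assumes "bicyclic_graph G n" "\<nexists>u v. cubic_edge G u v"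
  shows "8 * excess 2 3 < total_excess G"
proof -
  let ?P = "{v \<in> pverts G. degree G v = 1}"
  consider "?P = {}" | p where "?P = {p}" | p q where "p \<in> ?P" "q \<in> ?P" "p \<noteq> q"
    by blast
  then show ?thesis
  proof cases
    case 1
    then show ?thesis using total_excess_gt_no_pendant[OF assms(1) _ assms(2)] by blast
  next
    case 2
    then show ?thesis using total_excess_gt_one_pendant[OF assms(1)] by blast
  next
    case 3
    then show ?thesis using total_excess_gt_two_pendants[OF assms(1), of p q] by blast
  qed
qed

theorem HSO_bicyclic_bound:
  assumes "bicyclic_graph G n"
  shows "(real n - 3) * sqrt 2 + 2 * sqrt 13 \<le> HSO G"
    and "HSO G = (real n - 3) * sqrt 2 + 2 * sqrt 13 \<longleftrightarrow> (\<exists>u v. cubic_edge G u v)"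
proof -
  have G: "pair_graph G" "card (edges G) = n + 1"
    using assms by (auto simp: bicyclic_graph_def)
  have s: "sqrt (13/4) = sqrt 13 / 2"
    by (simp add: real_sqrt_divide)
  have HSO: "2 * HSO G = 2 * ((real n - 3) * sqrt 2 + 2 * sqrt 13) + (total_excess G - 8 * excess 2 3)"
    using HSO_eq_total_excess[OF G(1)] card_arcs_eq_twice_card_edges[OF G(1)] G(2)
    by (simp add: excess_2_3 s algebra_simps)
  show "(real n - 3) * sqrt 2 + 2 * sqrt 13 \<le> HSO G"
    and "HSO G = (real n - 3) * sqrt 2 + 2 * sqrt 13 \<longleftrightarrow> (\<exists>u v. cubic_edge G u v)"
    using HSO total_excess_gt[OF assms] total_excess_cubic_edge[OF G(1)]
    by (cases "\<exists>u v. cubic_edge G u v"; fastforce)+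
qed

section \<open>Isomorphisms\<close>

text \<open>
  Two graphs with the extremal degree pattern and equally many vertices have equally many arcs, so a
  bijection of their vertices only has to preserve arcs in one direction to be an isomorphism.
\<close>
lemma card_arcs_cubic_edge:
  assumes "pair_fin_digraph G" "cubic_edge G u v"
  shows "card (parcs G) = 2 * card (pverts G) + 2"
proof -
  interpret pair_fin_digraph G by fact
  let ?W = "pverts G - {u, v}"
  have uv: "u \<in> pverts G" "v \<in> pverts G" "u \<noteq> v" "degree G u = 3" "degree G v = 3"
      "\<And>w. w \<in> ?W \<Longrightarrow> degree G w = 2"
    using assms(2) by (auto simp: cubic_edge_def)
  have V: "pverts G = insert u (insert v ?W)"
    using uv by auto
  have fin: "finite ?W"
    using pair_finite_verts by simp
  have "(\<Sum>w\<in>pverts G. degree G w) = 6 + (\<Sum>w\<in>?W. degree G w)"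
    using uv fin by (subst V) simp
  also have "(\<Sum>w\<in>?W. degree G w) = 2 * card ?W"
    using uv(6) by simp
  also have "card (pverts G) = card ?W + 2"
    using uv fin by (subst V) simp
  then have "6 + 2 * card ?W = 2 * card (pverts G) + 2"
    by simp
  finally show ?thesis
    using card_arcs_eq_sum_degree[OF assms(1)] by simp
qed

lemma graph_isoI:
  assumes "pair_wf_digraph H" "finite (parcs G)"
    and "bij_betw f (pverts H) (pverts G)"
    and "\<And>x y. (x, y) \<in> parcs H \<Longrightarrow> (f x, f y) \<in> parcs G"
    and "card (parcs H) = card (parcs G)"
  shows "graph_iso G H"
proof -
  interpret H: pair_wf_digraph H by fact
  have inj: "inj_on f (pverts H)"
    using assms(3) by (simp add: bij_betw_def)
  then have inj_arcs: "inj_on (map_prod f f) (parcs H)"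
    using map_prod_inj_on[OF inj inj]
    by (rule_tac inj_on_subset) (auto dest: H.in_arcsD1 H.in_arcsD2)
  have arcs: "map_prod f f ` parcs H = parcs G"
    using assms(2,4,5) card_image[OF inj_arcs] by (intro card_subset_eq) auto
  let ?h = "\<lparr>iso_verts = f, iso_arcs = map_prod f f, iso_head = snd, iso_tail = fst\<rparr>"
  have "pre_digraph.digraph_isomorphism (with_proj H) ?h"
    using H.wf_digraph inj inj_arcs by (simp add: pre_digraph.digraph_isomorphism_def)
  moreover have "with_proj G = app_iso ?h (with_proj H)"
    using arcs assms(3) by (simp add: app_iso_def with_proj_def bij_betw_def)
  ultimately have "digraph_iso (with_proj H) (with_proj G)"
    unfolding digraph_iso_def by blast
  then show ?thesis
    by (rule digraph_iso_swap[OF H.wf_digraph])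
qed

lemma cubic_edge_graph_iso:
  assumes "pair_wf_digraph H" "graph_iso G H" "cubic_edge H u v"
  shows "\<exists>x y. cubic_edge G x y"
proof -
  interpret H: pair_wf_digraph H by fact
  obtain h where h: "pre_digraph.digraph_isomorphism (with_proj G) h"
      "with_proj H = app_iso h (with_proj G)"
    using assms(2) unfolding digraph_iso_def by blast
  then have "digraph_iso (with_proj G) (with_proj H)" unfolding digraph_iso_def by blast
  moreover have "wf_digraph (with_proj G)"
    using h(1) by (simp add: pre_digraph.digraph_isomorphism_def)
  ultimately have "digraph_iso (with_proj H) (with_proj G)"
    by (rule digraph_iso_swap[rotated])
  then obtain g where g: "pre_digraph.digraph_isomorphism (with_proj H) g"
      "with_proj G = app_iso g (with_proj H)"
    unfolding digraph_iso_def by blast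
  let ?f = "iso_verts g"
  have deg: "degree G (?f w) = degree H w" if "w \<in> pverts H" for w
    using H.out_degree_app_iso_eq[OF g(1), of w] that g(2) by simp
  have inj: "inj_on ?f (pverts H)"
    using g(1) by (simp add: pre_digraph.digraph_isomorphism_def)
  have verts: "pverts G = ?f ` pverts H"
    using arg_cong[OF g(2), of verts] by simp
  have "arcs_ends (with_proj G) = (\<lambda>(u, v). (?f u, ?f v)) ` parcs H"
    unfolding g(2) by (rule H.arcs_ends_app_iso_eq[OF g(1)])
  then have arcs: "parcs G = (\<lambda>(u, v). (?f u, ?f v)) ` parcs H"
    by simp
  have "cubic_edge G (?f u) (?f v)"
    using assms(3) inj_onD[OF inj, of u v] deg
    unfolding cubic_edge_def verts arcs by auto
  then show ?thesis by blast
qed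

section \<open>The graphs $C'_n$ and $C''_n$ have the extremal degree pattern\<close>

lemma cycle_arc_iff:
  assumes "3 \<le> p"
  shows "(x, y) \<in> parcs (cycle_graph p) \<longleftrightarrow>
    x < p \<and> (y = (if Suc x = p then 0 else Suc x) \<or> y = (if x = 0 then p - 1 else x - 1))"
proof -
  have m: "Suc i mod p = (if Suc i = p then 0 else Suc i)" if "i < p" for i
    using that by auto
  have "(x, y) \<in> parcs (cycle_graph p) \<longleftrightarrow> x < p \<and> y = Suc x mod p \<or> y < p \<and> x = Suc y mod p"
    by (auto simp: cycle_graph_def)
  also have "\<dots> \<longleftrightarrow> x < p \<and> y = (if Suc x = p then 0 else Suc x) \<or>
      y < p \<and> x = (if Suc y = p then 0 else Suc y)"
    by (simp add: m cong: conj_cong)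
  also have "y < p \<and> x = (if Suc y = p then 0 else Suc y) \<longleftrightarrow>
      x < p \<and> y = (if x = 0 then p - 1 else x - 1)"
    using assms by auto
  finally show ?thesis
    by blast
qed

lemma cycle_arcs_from:
  assumes "3 \<le> p"
  shows "{y. (x, y) \<in> parcs (cycle_graph p)} =
    (if x < p then {if Suc x = p then 0 else Suc x, if x = 0 then p - 1 else x - 1} else {})"
  unfolding cycle_arc_iff[OF assms] by (cases "x < p") auto

lemma cycle_arc_in_verts:
  "(x, y) \<in> parcs (cycle_graph p) \<Longrightarrow> x < p \<and> y < p"
  by (auto simp: cycle_graph_def)

lemma pverts_cycle [simp]: "pverts (cycle_graph p) = {..<p}"
  by (simp add: cycle_graph_def)

lemma cubic_edge_joined_cycles:
  assumes "3 \<le> p" "3 \<le> q"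
  shows "pair_fin_digraph (joined_cycles p q)"
    and "cubic_edge (joined_cycles p q) (Inl 0) (Inr 0)"
proof -
  let ?G = "joined_cycles p q"
  have verts: "pverts ?G = {..<p} <+> {..<q}"
    by (simp add: joined_cycles_def)
  have wf: "fst a \<in> pverts ?G" "snd a \<in> pverts ?G" if "a \<in> parcs ?G" for a
    using that assms by (auto simp: joined_cycles_def dest: cycle_arc_in_verts)
  show "pair_fin_digraph ?G"
  proof
    show "finite (pverts ?G)" by (simp add: verts)
    moreover have "parcs ?G \<subseteq> pverts ?G \<times> pverts ?G"
      using wf by force
    ultimately show "finite (parcs ?G)"
      by (meson finite_SigmaI finite_subset)
  qed (use wf in auto)
  \<comment> \<open>Both sides gain one neighbour at \<open>0\<close> from the joining edge.\<close>
  have l: "{y. (Inl i, y) \<in> parcs ?G} = Inl ` {y. (i, y) \<in> parcs (cycle_graph p)} \<union> (if i = 0 then {Inr 0} else {})" for i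
    by (auto simp: joined_cycles_def)
  have r: "{y. (Inr i, y) \<in> parcs ?G} = Inr ` {y. (i, y) \<in> parcs (cycle_graph q)} \<union> (if i = 0 then {Inl 0} else {})" for i
    by (auto simp: joined_cycles_def)
  have dl: "degree ?G (Inl i) = (if i = 0 then 3 else 2)" if "i < p" for i
    using assms that unfolding degree_conv_card l cycle_arcs_from[OF assms(1)]
    by auto
  have dr: "degree ?G (Inr i) = (if i = 0 then 3 else 2)" if "i < q" for i
    using assms that unfolding degree_conv_card r cycle_arcs_from[OF assms(2)]
    by auto
  show "cubic_edge ?G (Inl 0) (Inr 0)"
    using assms unfolding cubic_edge_def verts
    by (auto simp: dl dr split: if_splits) (auto simp: joined_cycles_def)
qed

lemma pverts_merged_cycles:
  assumes "3 \<le> p" "3 \<le> q"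
  shows "pverts (merged_cycles p q) = {..<p + q - 2}"
proof -
  have "glue p ` {..<q} = {0, 1} \<union> {p..<p + q - 2}"
  proof (intro set_eqI iffI)
    fix x assume "x \<in> {0, 1} \<union> {p..<p + q - 2}"
    then have "x = glue p (if x < 2 then x else x - p + 2)" "(if x < 2 then x else x - p + 2) < q"
      using assms by (auto simp: glue_def)
    then show "x \<in> glue p ` {..<q}" by blast
  qed (use assms in \<open>auto simp: glue_def split: if_splits\<close>)
  then show ?thesis
    using assms by (auto simp: merged_cycles_def)
qed

lemma merged_arc_iff:
  "(x, y) \<in> parcs (merged_cycles p q) \<longleftrightarrow> (x, y) \<in> parcs (cycle_graph p) \<or>
    (\<exists>a b. (a, b) \<in> parcs (cycle_graph q) \<and> x = glue p a \<and> y = glue p b)"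
  by (force simp: merged_cycles_def)

lemma cubic_edge_merged_cycles:
  assumes "3 \<le> p" "3 \<le> q"
  shows "pair_fin_digraph (merged_cycles p q)"
    and "cubic_edge (merged_cycles p q) 0 1"
proof -
  let ?G = "merged_cycles p q"
  note arc = cycle_arc_iff[OF assms(1)] cycle_arc_iff[OF assms(2)]
  have wf: "fst a \<in> pverts ?G" "snd a \<in> pverts ?G" if "a \<in> parcs ?G" for a
    using that by (cases a; auto simp: merged_cycles_def dest: cycle_arc_in_verts)+
  show "pair_fin_digraph ?G"
  proof
    show "finite (pverts ?G)" by (simp add: pverts_merged_cycles assms)
    moreover have "parcs ?G \<subseteq> pverts ?G \<times> pverts ?G"
      using wf by force
    ultimately show "finite (parcs ?G)"
      by (meson finite_SigmaI finite_subset)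
  qed (use wf in auto)
  \<comment> \<open>Only the two shared vertices have neighbours in both cycles.\<close>
  have from_old: "{y. (i, y) \<in> parcs ?G} = {y. (i, y) \<in> parcs (cycle_graph p)} \<union>
      (if i < 2 then glue p ` {y. (i, y) \<in> parcs (cycle_graph q)} else {})" if "i < p" for i
    using that assms by (force simp: merged_cycles_def glue_def)
  have from_new: "{y. (p + j, y) \<in> parcs ?G} = glue p ` {y. (j + 2, y) \<in> parcs (cycle_graph q)}" for j
  proof -
    have glue: "p + j = glue p a \<longleftrightarrow> a = j + 2" for a
      using assms by (auto simp: glue_def)
    have "(p + j, y) \<notin> parcs (cycle_graph p)" for y
      using cycle_arc_in_verts[of "p + j" y p] by auto
    then have "(p + j, y) \<in> parcs ?G \<longleftrightarrow> (\<exists>b. (j + 2, b) \<in> parcs (cycle_graph q) \<and> y = glue p b)" for y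
      unfolding merged_arc_iff glue by blast
    then show ?thesis
      by auto
  qed
  have old: "degree ?G i = (if i < 2 then 3 else 2)" if "i < p" for i
    using assms that unfolding degree_conv_card from_old[OF that] cycle_arcs_from[OF assms(1)]
      cycle_arcs_from[OF assms(2)]
    by (auto simp: glue_def card_insert_if)
  have new: "degree ?G i = 2" if "p \<le> i" "i < p + q - 2" for i
  proof -
    have "inj (glue p)"
      using assms(1) by (auto simp: inj_def glue_def)
    then have "card (glue p ` A) = card A" for A
      by (meson card_image inj_on_subset subset_UNIV)
    moreover have "i = p + (i - p)"
      using that by simp
    ultimately have "degree ?G i = card {y. (i - p + 2, y) \<in> parcs (cycle_graph q)}"
      using from_new[of "i - p"] by (simp add: degree_conv_card)
    then show ?thesis
      using that assms by (simp add: cycle_arcs_from)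
  qed
  have "degree ?G i = 2" if "i < p + q - 2" "2 \<le> i" for i
    using old[of i] new[of i] that by (cases "i < p") auto
  moreover have "(0, 1) \<in> parcs ?G"
    using assms by (auto simp: merged_cycles_def arc)
  ultimately show "cubic_edge ?G 0 1"
    using assms old[of 0] old[of 1] unfolding cubic_edge_def pverts_merged_cycles[OF assms] by auto
qed

section \<open>Cycles in 2-regular graphs\<close>

lemma cycle_arc_map:
  assumes "3 \<le> p" "sym E" "\<And>i. i < p \<Longrightarrow> (f i, f (Suc i mod p)) \<in> E"
    and "(x, y) \<in> parcs (cycle_graph p)"
  shows "(f x, f y) \<in> E"
  using assms(2-4) by (auto simp: cycle_graph_def dest: symD)

lemma card_2_third_elem:
  assumes "card A = 2" "a \<in> A" "b \<in> A" "a \<noteq> b" "y \<in> A"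
  shows "y = a \<or> y = b"
  using assms by (auto simp: card_2_iff)

text \<open>
  Walk from \<open>u\<close>, never turning back.  By finiteness the walk revisits a vertex; the first revisited
  vertex is \<open>u\<close> itself, since at any other vertex both edges are already used up when it is left.
  The cycle closed up in this way contains both neighbours of each of its vertices, so it is a whole
  connected component.
\<close>
lemma two_regular_cycle_through:
  assumes "finite V" "E \<subseteq> V \<times> V" "sym E" "irrefl E"
    and two: "\<And>x. x \<in> V \<Longrightarrow> card {y. (x, y) \<in> E} = 2"
    and "u \<in> V"
  obtains p f where "3 \<le> p" "inj_on f {..<p}" "f 0 = u" "f ` {..<p} \<subseteq> V"
    "\<And>i. i < p \<Longrightarrow> (f i, f (Suc i mod p)) \<in> E"
    "\<And>i y. i < p \<Longrightarrow> (f i, y) \<in> E \<Longrightarrow> y \<in> f ` {..<p}"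
proof -
  have other: "\<exists>y. (x, y) \<in> E \<and> y \<noteq> a" if x: "x \<in> V" for x a
  proof -
    obtain b c where "{y. (x, y) \<in> E} = {b, c}" "b \<noteq> c"
      using two[OF x] unfolding card_2_iff by blast
    then show ?thesis by (cases "b = a") blast+
  qed
  have third: "y = a \<or> y = b" if "(x, a) \<in> E" "(x, b) \<in> E" "a \<noteq> b" "(x, y) \<in> E" for x a b y
  proof -
    have "x \<in> V" using that(1) assms(2) by blast
    then show ?thesis
      using card_2_third_elem[OF two, of x a b y] that by blast
  qed
  \<comment> \<open>The walk is chosen as a sequence of arcs, so that each step knows where it came from.\<close>
  have "\<exists>s. \<forall>i. (s i \<in> E \<and> (i = 0 \<longrightarrow> fst (s i) = u)) \<and>
      (fst (s (Suc i)) = snd (s i) \<and> snd (s (Suc i)) \<noteq> fst (s i))"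
  proof (rule dependent_nat_choice)
    show "\<exists>a. a \<in> E \<and> ((0::nat) = 0 \<longrightarrow> fst a = u)"
      using other[OF \<open>u \<in> V\<close>] by force
    show "\<exists>b. (b \<in> E \<and> (Suc i = 0 \<longrightarrow> fst b = u)) \<and> fst b = snd a \<and> snd b \<noteq> fst a"
      if "a \<in> E \<and> (i = 0 \<longrightarrow> fst a = u)" for a and i :: nat
      using other[of "snd a" "fst a"] that assms(2) by force
  qed
  then obtain s where s: "\<And>i. s i \<in> E" "fst (s 0) = u"
      "\<And>i. fst (s (Suc i)) = snd (s i)" "\<And>i. snd (s (Suc i)) \<noteq> fst (s i)"
    by blast
  define f where "f i = fst (s i)" for i
  have step: "(f i, f (Suc i)) \<in> E" for i
    using s(1)[of i] s(3)[of i] by (simp add: f_def)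
  have rev_step: "(f (Suc i), f i) \<in> E" for i
    using step assms(3) by (blast dest: symD)
  have no_turn: "f (Suc (Suc i)) \<noteq> f i" for i
    using s(3)[of "Suc i"] s(4)[of i] by (simp add: f_def)
  have loopfree: "f (Suc i) \<noteq> f i" for i
    using step[of i] assms(4) by (auto simp: irrefl_def)
  have in_V: "f i \<in> V" for i
    using step assms(2) by blast
  have "\<not> inj f"
    using in_V assms(1) by (meson finite_subset image_subsetI infinite_UNIV_nat finite_imageD)
  then have "\<exists>p. \<exists>j<p. f p = f j"
    unfolding inj_on_def by (metis linorder_neqE_nat)
  define p where "p = (LEAST p. \<exists>j<p. f p = f j)"
  obtain j where j: "j < p" "f p = f j"
    using LeastI_ex[OF \<open>\<exists>p. \<exists>j<p. f p = f j\<close>] unfolding p_def by blast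
  have first: "f i \<noteq> f k" if "k < i" "i < p" for i k
    using not_less_Least[of i "\<lambda>p. \<exists>j<p. f p = f j"] that unfolding p_def by blast
  then have inj: "inj_on f {..<p}"
    by (intro linorder_inj_onI') (metis lessThan_iff)
  obtain r where r: "p = Suc r" using j(1) by (cases p) auto
  \<comment> \<open>Otherwise \<open>f r\<close>, the last vertex before the revisit, is a neighbour of \<open>f j\<close> and hence the one
    before or after \<open>f j\<close> on the walk; this is a loop, a turn back or an earlier revisit.\<close>
  have "j = 0"
  proof (rule ccontr)
    assume "j \<noteq> 0"
    then obtain i where i: "j = Suc i" by (cases j) auto
    have "(f j, f r) \<in> E" using rev_step[of r] j(2) r by simp
    then have "f r = f i \<or> f r = f (Suc j)"
      using third[of "f j" "f i" "f (Suc j)" "f r"] rev_step[of i] step[of j] no_turn[of i] i by force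
    moreover have "f r \<noteq> f i"
      using first[of i r] i j(1) r by simp
    moreover have "f r \<noteq> f (Suc j)"
    proof
      assume *: "f r = f (Suc j)"
      have "Suc j \<noteq> p" using loopfree[of j] j(2) by metis
      then have "Suc j \<le> r" using j(1) r by simp
      then have "r = Suc j"
        using first[of "Suc j" r] * r by (metis le_neq_implies_less lessI)
      then show False using no_turn[of j] j(2) r by simp
    qed
    ultimately show False by blast
  qed
  then have close: "f p = f 0" using j by simp
  have "p \<noteq> 1" "p \<noteq> 2"
    using close loopfree[of 0] no_turn[of 0] by (auto simp: numeral_2_eq_2)
  then have p: "3 \<le> p" using j(1) by simp
  have mod: "f (Suc i mod p) = f (Suc i)" if "i < p" for i
    using that close by (cases "Suc i = p") auto
  show ?thesis
  proof (rule that)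
    show "f 0 = u" using s(2) by (simp add: f_def)
    show "f ` {..<p} \<subseteq> V" using in_V by blast
    show "(f i, f (Suc i mod p)) \<in> E" if "i < p" for i
      using step[of i] mod[OF that] by simp
    show "y \<in> f ` {..<p}" if "i < p" "(f i, y) \<in> E" for i y
    proof -
      have next_in: "f (Suc i) \<in> f ` {..<p}"
        using mod[OF that(1)] p by (metis imageI lessThan_iff mod_less_divisor that(1) gr_zeroI not_less_zero)
      show ?thesis
      proof (cases i)
        case 0
        have "f 1 \<noteq> f r" using first[of 1 r] p r by simp
        then have "y = f 1 \<or> y = f r"
          using third[of "f 0" "f 1" "f r" y] step[of 0] rev_step[of r] close r that(2) 0 by simp
        then show ?thesis using p r by auto
      next
        case (Suc k)
        then have "y = f k \<or> y = f (Suc i)"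
          using third[of "f i" "f k" "f (Suc i)" y] step[of i] rev_step[of k] no_turn[of k] that(2) by force
        then show ?thesis using next_in Suc that(1) by auto
      qed
    qed
  qed (use p inj in auto)
qed

section \<open>Classification of the extremal graphs\<close>

text \<open>
  A cycle \<open>f 0, \<dots>, f (p - 1)\<close> with a chord between \<open>f 0\<close> and \<open>f k\<close> contains merged cycles.
  The chord becomes the shared edge \<open>{0, 1}\<close>, with \<open>f k\<close> as \<open>0\<close> and \<open>f 0\<close> as \<open>1\<close>.  The first cycle
  continues from \<open>1\<close> forwards along \<open>f 1, \<dots>, f (k - 1)\<close>; the fresh vertices
  \<open>k + 1, \<dots>, p - 1\<close> of the second one also start at the neighbour of \<open>1\<close>, so they run backwards
  along \<open>f (p - 1), \<dots>, f (k + 1)\<close>.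
\<close>
lemma merged_cycles_chord_hom:
  assumes "2 \<le> k" "k + 2 \<le> p" "sym A"
    and f: "\<And>i. i < p \<Longrightarrow> (f i, f (Suc i mod p)) \<in> A"
    and chord: "(f 0, f k) \<in> A"
    and xy: "(x, y) \<in> parcs (merged_cycles (k + 1) (p - k + 1))"
  defines "g \<equiv> \<lambda>x. if x = 0 then f k else if x \<le> k then f (x - 1) else f (p + k - x)"
  shows "(g x, g y) \<in> A"
proof -
  have f1: "(f i, f (Suc i)) \<in> A" if "Suc i < p" for i
    using f[of i] that by simp
  have f0: "(f (p - 1), f 0) \<in> A"
    using f[of "p - 1"] assms(1,2) by simp
  have first: "(g i, g (Suc i mod (k + 1))) \<in> A" if i: "i < k + 1" for i
  proof -
    consider "i = 0" | "0 < i" "i < k" | "i = k" using i by linarith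
    then show ?thesis
    proof cases
      case 1
      then show ?thesis using assms(1) symD[OF assms(3) chord] by (simp add: g_def)
    next
      case 2
      then show ?thesis using f1[of "i - 1"] assms(2) by (simp add: g_def)
    next
      case 3
      then show ?thesis using f1[of "k - 1"] assms(1,2) by (simp add: g_def)
    qed
  qed
  have second: "(g (glue (k + 1) i), g (glue (k + 1) (Suc i mod (p - k + 1)))) \<in> A"
    if i: "i < p - k + 1" for i
  proof -
    consider "i = 0" | "i = 1" | "2 \<le> i" "i < p - k" | "i = p - k"
      using i by linarith
    then show ?thesis
    proof cases
      case 1
      then show ?thesis using assms(1,2) symD[OF assms(3) chord] by (simp add: g_def glue_def)
    next
      case 2
      then show ?thesis using assms(1,2) symD[OF assms(3) f0] by (simp add: g_def glue_def)
    next
      case 3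
      then have "p + k - (k + 1 + (i - 2)) = Suc (p - i)" "p + k - (k + 1 + (Suc i - 2)) = p - i"
        using assms(1,2) by auto
      then show ?thesis using 3 assms(1,2) symD[OF assms(3) f1[of "p - i"]]
        by (simp add: g_def glue_def)
    next
      case 4
      then have "glue (k + 1) i = p - 1" "\<not> p - 1 \<le> k" "p - 1 \<noteq> 0" "p + k - (p - 1) = Suc k"
        using assms(1,2) by (auto simp: glue_def)
      then have "g (glue (k + 1) i) = f (Suc k)"
        by (simp add: g_def)
      moreover have "Suc i mod (p - k + 1) = 0"
        using 4 by simp
      ultimately show ?thesis
        using assms(1,2) symD[OF assms(3) f1[of k]] by (simp add: g_def glue_def)
    qed
  qed
  have k: "3 \<le> k + 1" "3 \<le> p - k + 1" using assms(1,2) by auto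
  from xy consider "(x, y) \<in> parcs (cycle_graph (k + 1))"
    | a b where "(a, b) \<in> parcs (cycle_graph (p - k + 1))" "x = glue (k + 1) a" "y = glue (k + 1) b"
    by (auto simp: merged_cycles_def)
  then show ?thesis
  proof cases
    case 1
    then show ?thesis using cycle_arc_map[OF k(1) assms(3), of g] first by blast
  next
    case 2
    then show ?thesis using cycle_arc_map[OF k(2) assms(3), of "\<lambda>i. g (glue (k + 1) i)"] second by blast
  qed
qed

text \<open>
  Deleting the edge \<open>{u, v}\<close> leaves a 2-regular graph.  If the cycle through \<open>u\<close> in it also contains
  \<open>v\<close>, then it is spanning by connectedness and \<open>{u, v}\<close> is a chord of it.  Otherwise
  \<open>{u, v}\<close> joins the disjoint cycles through \<open>u\<close> and \<open>v\<close>, which together are spanning.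
\<close>
theorem cubic_edge_classification:
  assumes "pair_graph G" "Digraph_Component.connected (with_proj G)" "cubic_edge G u v"
  shows "(\<exists>p q. 3 \<le> p \<and> 3 \<le> q \<and> p + q = card (pverts G) \<and> graph_iso G (joined_cycles p q)) \<or>
    (\<exists>p q. 3 \<le> p \<and> 3 \<le> q \<and> p + q - 2 = card (pverts G) \<and> graph_iso G (merged_cycles p q))"
proof -
  interpret pair_graph G by fact
  have uv: "(u, v) \<in> parcs G" "(v, u) \<in> parcs G" "u \<noteq> v" "u \<in> pverts G" "v \<in> pverts G"
    "degree G u = 3" "degree G v = 3" "\<And>w. w \<in> pverts G \<Longrightarrow> w \<notin> {u, v} \<Longrightarrow> degree G w = 2"
    using assms(3) arcs_symmetric by (auto simp: cubic_edge_def)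
  define E where "E = parcs G - {(u, v), (v, u)}"
  have sym: "sym (parcs G)" using arcs_symmetric by (auto intro: symI)
  have E: "E \<subseteq> pverts G \<times> pverts G" "sym E" "irrefl E"
    using in_arcsD1 in_arcsD2 arcs_symmetric
    by (auto simp: E_def irrefl_def sym_def dest: no_loops')
  have two: "card {y. (x, y) \<in> E} = 2" if "x \<in> pverts G" for x
  proof -
    consider "x = u" | "x = v" | "x \<notin> {u, v}" by blast
    then show ?thesis
    proof cases
      case 1
      then have "{y. (x, y) \<in> E} = {y. (u, y) \<in> parcs G} - {v}" using uv(3) by (auto simp: E_def)
      then show ?thesis using uv(1,6) by (simp add: degree_conv_card)
    next
      case 2
      then have "{y. (x, y) \<in> E} = {y. (v, y) \<in> parcs G} - {u}" using uv(3) by (auto simp: E_def)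
      then show ?thesis using uv(2,7) by (simp add: degree_conv_card)
    next
      case 3
      then have "{y. (x, y) \<in> E} = {y. (x, y) \<in> parcs G}" by (auto simp: E_def)
      then show ?thesis using uv(8)[OF that 3] by (simp add: degree_conv_card)
    qed
  qed
  note cycle_through = two_regular_cycle_through[OF pair_finite_verts E two]
  obtain p f where f: "3 \<le> p" "inj_on f {..<p}" "f 0 = u" "f ` {..<p} \<subseteq> pverts G"
    "\<And>i. i < p \<Longrightarrow> (f i, f (Suc i mod p)) \<in> E"
    "\<And>i y. i < p \<Longrightarrow> (f i, y) \<in> E \<Longrightarrow> y \<in> f ` {..<p}"
    using cycle_through[OF _ uv(4)] by blast
  have EA: "E \<subseteq> parcs G" by (auto simp: E_def)
  show ?thesis
  proof (cases "v \<in> f ` {..<p}")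
    case True
    then obtain k where k: "k < p" "v = f k" by blast
    have "k \<noteq> 0" using k(2) f(3) uv(3) by metis
    moreover have "k \<noteq> 1"
      using f(5)[of 0] f(1,3) k(2) by (auto simp: E_def)
    moreover have "k \<noteq> p - 1"
      using f(5)[of "p - 1"] f(1,3) k(2) by (auto simp: E_def)
    ultimately have k2: "2 \<le> k" "k + 2 \<le> p" using k(1) by auto
    have V: "f ` {..<p} = pverts G"
    proof (rule connected_closed_set_eq_verts[OF assms(1,2) f(4)])
      show "u \<in> f ` {..<p}" using f(1,3) by force
      show "b \<in> f ` {..<p}" if "a \<in> f ` {..<p}" "(a, b) \<in> parcs G" for a b
        using that f(6) True \<open>u \<in> f ` {..<p}\<close> by (cases "(a, b) \<in> E") (auto simp: E_def)
    qed
    define g where "g = (\<lambda>x. if x = 0 then f k else if x \<le> k then f (x - 1) else f (p + k - x))"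
    let ?p = "k + 1" and ?q = "p - k + 1"
    have pq: "3 \<le> ?p" "3 \<le> ?q" "?p + ?q - 2 = p" using k2 by auto
    have inj: "inj_on g {..<p}"
    proof -
      \<comment> \<open>The index map behind \<open>g\<close>, a permutation of the indices below \<open>p\<close>.\<close>
      define h where "h x = (if x = 0 then k else if x \<le> k then x - 1 else p + k - x)" for x
      have "inj_on h {..<p}" using k2 by (intro inj_onI) (auto simp: h_def split: if_splits)
      moreover have "h ` {..<p} \<subseteq> {..<p}" using k2 by (auto simp: h_def)
      moreover have "g = f \<circ> h" by (auto simp: g_def h_def)
      ultimately show ?thesis using f(2) by (auto intro: comp_inj_on inj_on_subset)
    qed
    have card: "card (pverts G) = p" using V card_image[OF f(2)] by simp
    have "g ` {..<p} \<subseteq> pverts G" using k2 by (auto simp: g_def simp flip: V)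
    then have "g ` {..<p} = pverts G"
      using card card_image[OF inj] by (intro card_subset_eq) auto
    then have bij: "bij_betw g (pverts (merged_cycles ?p ?q)) (pverts G)"
      using inj unfolding pverts_merged_cycles[OF pq(1,2)] pq(3) by (simp add: bij_betw_def)
    note M = cubic_edge_merged_cycles[OF pq(1,2)]
    have "graph_iso G (merged_cycles ?p ?q)"
    proof (rule graph_isoI[OF _ pair_finite_arcs bij])
      show "pair_wf_digraph (merged_cycles ?p ?q)"
        using M(1) by (simp add: pair_fin_digraph_def)
      show "(g x, g y) \<in> parcs G" if "(x, y) \<in> parcs (merged_cycles ?p ?q)" for x y
        unfolding g_def
        by (rule merged_cycles_chord_hom[OF k2 sym _ _ that]) (use f(3,5) EA uv(1) k(2) in auto)
      show "card (parcs (merged_cycles ?p ?q)) = card (parcs G)"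
        using card_arcs_cubic_edge[OF M] card_arcs_cubic_edge[OF pair_fin_digraph assms(3)]
          card pq by (simp add: pverts_merged_cycles)
    qed
    with pq card show ?thesis by metis
  next
    case False
    obtain q h where h: "3 \<le> q" "inj_on h {..<q}" "h 0 = v" "h ` {..<q} \<subseteq> pverts G"
      "\<And>i. i < q \<Longrightarrow> (h i, h (Suc i mod q)) \<in> E"
      "\<And>i y. i < q \<Longrightarrow> (h i, y) \<in> E \<Longrightarrow> y \<in> h ` {..<q}"
      using cycle_through[OF _ uv(5)] by blast
    have avoid: "h i \<notin> f ` {..<p}" if "i < q" for i
      using that
    proof (induction i)
      case 0
      then show ?case using False h(3) by simp
    next
      case (Suc i)
      have "(h (Suc i), h i) \<in> E"
        using h(5)[of i] Suc.prems E(2) by (auto dest: symD)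
      then show ?case using Suc f(6) by auto
    qed
    have disj: "f i \<noteq> h j" if "i < p" "j < q" for i j
      using avoid[OF that(2)] that(1) by force
    have u_in: "u \<in> f ` {..<p}" "v \<in> h ` {..<q}" using f(1,3) h(1,3) by force+
    have V: "f ` {..<p} \<union> h ` {..<q} = pverts G"
    proof (rule connected_closed_set_eq_verts[OF assms(1,2)])
      show "u \<in> f ` {..<p} \<union> h ` {..<q}" using u_in by blast
      show "b \<in> f ` {..<p} \<union> h ` {..<q}" if "a \<in> f ` {..<p} \<union> h ` {..<q}" "(a, b) \<in> parcs G" for a b
        using that f(6) h(6) u_in by (cases "(a, b) \<in> E") (auto simp: E_def)
    qed (use f(4) h(4) in blast)
    define g where "g = case_sum f h"
    have verts: "pverts (joined_cycles p q) = {..<p} <+> {..<q}"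
      by (simp add: joined_cycles_def)
    have inj: "inj_on g (pverts (joined_cycles p q))"
      unfolding verts g_def using f(2) h(2) disj disj[symmetric] by (auto simp: inj_on_def)
    have "g ` pverts (joined_cycles p q) = pverts G"
      unfolding verts V[symmetric] g_def by (auto simp: image_Un image_image Plus_def)
    then have bij: "bij_betw g (pverts (joined_cycles p q)) (pverts G)"
      using inj by (simp add: bij_betw_def)
    have card: "card (pverts G) = p + q"
      using bij_betw_same_card[OF bij] verts by (simp add: card_Plus)
    note J = cubic_edge_joined_cycles[OF f(1) h(1)]
    have "graph_iso G (joined_cycles p q)"
    proof (rule graph_isoI[OF _ pair_finite_arcs bij])
      show "pair_wf_digraph (joined_cycles p q)"
        using J(1) by (simp add: pair_fin_digraph_def)
      show "(g x, g y) \<in> parcs G" if "(x, y) \<in> parcs (joined_cycles p q)" for x y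
        using that cycle_arc_map[where f = f, OF f(1) E(2) f(5)]
          cycle_arc_map[where f = h, OF h(1) E(2) h(5)] EA uv f(3) h(3)
        by (auto simp: g_def joined_cycles_def)
      show "card (parcs (joined_cycles p q)) = card (parcs G)"
        using card_arcs_cubic_edge[OF J] card_arcs_cubic_edge[OF pair_fin_digraph assms(3)]
          card verts by (simp add: card_Plus)
    qed
    with f(1) h(1) card show ?thesis by metis
  qed
qed

theorem theorem3p3:
  fixes G :: "'a pair_pre_digraph" and n :: nat
  assumes "bicyclic_graph G n"
  shows "HSO G \<ge> (real n - 3) * sqrt 2 + 2 * sqrt 13 \<and>
    (HSO G = (real n - 3) * sqrt 2 + 2 * sqrt 13 \<longleftrightarrow>
      (\<exists>p q. 3 \<le> p \<and> 3 \<le> q \<and> p + q = n \<and> graph_iso G (joined_cycles p q)) \<or>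
      (\<exists>p q. 3 \<le> p \<and> 3 \<le> q \<and> p + q - 2 = n \<and> graph_iso G (merged_cycles p q)))"
proof -
  have G: "pair_graph G" "Digraph_Component.connected (with_proj G)" "card (pverts G) = n"
    using assms by (auto simp: bicyclic_graph_def)
  have "\<exists>u v. cubic_edge G u v" if "3 \<le> p" "3 \<le> q" "graph_iso G (joined_cycles p q)" for p q
    using cubic_edge_joined_cycles[OF that(1,2)] cubic_edge_graph_iso[OF _ that(3)]
    by (auto simp: pair_fin_digraph_def)
  moreover have "\<exists>u v. cubic_edge G u v" if "3 \<le> p" "3 \<le> q" "graph_iso G (merged_cycles p q)" for p q
    using cubic_edge_merged_cycles[OF that(1,2)] cubic_edge_graph_iso[OF _ that(3)]
    by (auto simp: pair_fin_digraph_def)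
  ultimately show ?thesis
    using HSO_bicyclic_bound[OF assms] cubic_edge_classification[OF G(1,2)] G(3) by blast
qed

end
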